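(* Let $\Gamma$ be a game of the extensive form with unawareness and let $i \in I$ be a player. If player $i$ has perfect recall, i.e. whenever $i$ is active at two distinct nodes $n_1, n_k$ and there is a path $n_1, n_2, \dots, n_k$ along which $i$ takes action $a_i$ at $n_1$, then for every $n' \in h_i(n_k)$ there are a node $n'_1 \neq n'$ and a path $n'_1, \dots, n'_\ell = n'$ such that $h_i(n'_1) = h_i(n_1)$ and $i$ takes action $a_i$ at $n'_1$ along it, then for every mixed strategy $\sigma_i \in \Delta(S_i)$ of player $i$ there exists a behavior strategy $\beta_i \in B_i$ that is realization-equivalent to $\sigma_i$, i.e. such that $o(n \mid \sigma_i, s_{-i}) = o(n \mid \beta_i, s_{-i})$ for every node $n \in \mathbf{N}$ and every $s_{-i} \in S_{-i}$.
   Context: **Base tree.** $I$ is a finite set of players, $0$ denotes nature (possibly absent), and $I^0$ is the set of players including nature. $\bar T$ is a finite rooted directed tree with node set $\bar N = \bar D \cup \bar Z$ (disjoint; $\bar D \neq \emptyset$ decision nodes, $\bar Z$ terminal nodes) and precedence relation $\bar\lessdot$. Each $n \in \bar D$ has a nonempty set $P(n) \subseteq I^0$ of active players, each $i \in P(n)$ has a nonempty finite action set $A_i(n)$, and there is a bijection $\psi_n$ from $\prod_{i \in P(n)} A_i(n)$ onto the immediate successors of $n$. Terminal nodes have no successors and carry payoffs $(u_i(z))_{i\in I}$. **Forest.** A subtree $T$ of $\bar T$ is given by a set of nodes $N \subseteq \bar N$ with $N \cap \bar D \neq \emptyset$ such that $N$ with the restricted precedence relation is a tree. Write $T' \preceq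 T''$ if the nodes of $T'$ are a subset of the nodes of $T''$. $\mathbf{T}$ is a finite join-semilattice (under $\preceq$) of subtrees of $\bar T$, with top element $\bar T \in \mathbf{T}$, such that: (0) if $n \,\bar\lessdot\, n' \,\bar\lessdot\, n''$ and $n, n''$ are in $T \in \mathbf{T}$, then $n'$ is in $T$; (1) all terminal nodes of each $T \in \mathbf{T}$ are in $\bar Z$; (2) for every $T \in \mathbf{T}$, decision node $n \in T$ and $i \in P(n)$ there is a nonempty $A_i^T(n) \subseteq A_i(n)$ such that $\psi_n$ maps $\prod_{i \in P(n)} A_i^T(n)$ bijectively onto the immediate successors of $n$ in $T$; (3) for any $T\in\mathbf{T}$ and decision nodes $n,n' \in T$ with $i \in P(n)\cap P(n')$, if $A_i(n) \cap A_i(n') \neq \emptyset$ then $A_i(n) = A_i(n')$. Appearances of the same node in different trees are treated as distinct objects: $n_T$ is the copy in $T$ of a node $n$ (if it exists in $T$), copies commute ($(n_{T'})_T = n_T$), and $n_T = n$ if $n \in T$. $\mathbf{N}$ and $\mathbf{D}$ are the disjoint unions over $T \in \mathbf{T}$ of all nodes and of all decision nodes; $\mathbf{D}_i$ is the set of nodes in $\mathbf{D}$ at which $i$ is active; $T_n$ is the tree containing $n \in \mathbf{N}$. For a node $n$ of a tree $T$, $A_i(n)$ denotes the actions available at $n$ in $T$, i.e. $A_i^T(n)$. Paths are directed paths within one tree. **Information sets.** For each $n \in \mathbf{D}$ and $i \in P(n)\setminus\{0\}$ there is a nonempty information set $h_i(n) \subseteq \mathbf{D}_i$ such that: (I2)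 if $n' \in h_i(n)$ then $h_i(n') = h_i(n)$; (I3) if $n' \in h_i(n) \subseteq T'$ and there is a path $n',\dots,n''$ in $T'$ with $i \in P(n') \cap P(n'')$, then $h_i(n'') \subseteq T'$; (I4) if $n' \in h_i(n)$ then $A_i(n') \subseteq A_i(n)$; (I5) for $T \in \mathbf{T}$ and decision nodes $n,n' \in T$, if $A_i(n) = A_i(n')$ then $h_i(n') = h_i(n)$; (U0) if $n \in T$ and $i \in P(n)$, there is $T' \in \mathbf{T}$, $T' \preceq T$, with $h_i(n) \subseteq T'$; (U1) if $n \in T$ and $h_i(n) \subseteq T'$, then the copy $n_{T'}$ exists and $n_{T'} \in h_i(n)$; (U4) if $T \preceq T' \preceq T''$, $n \in T''$, $h_i(n) \subseteq T$ and $T'$ contains the copy $n_{T'}$, then $h_i(n_{T'}) = h_i(n)$; (U5) if $T \preceq T' \preceq T''$, $n \in T''$, $h_i(n) \subseteq T'$ and $T$ contains the copy $n_T$, then $h_i(n_T)$ consists of the copies that exist in $T$ of the nodes of $h_i(n)$. These data form a *game of the extensive form with unawareness* $\Gamma$. $H_i$ is the set of all information sets of player $i$ (in all trees). All nodes in an information set $h_i$ have the same action set for $i$, written $A_i(h_i)$. **Perfect recall (I6) for player $i$:** if $i$ is active at two distinct nodes $n_1, n_k$ and there is a path $n_1, n_2, \dots, n_k$ along which $i$ takes action $a_i$ at $n_1$, then for every $n' \in h_i(n_k)$ there are a node $n'_1 \neq n'$ and a path $n'_1, \dots, n'_\ell = n'$ such that $h_i(n'_1) = h_i(n_1)$ and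 $i$ takes action $a_i$ at $n'_1$ along it. **Strategies.** Pure strategies: $S_i = \prod_{h_i \in H_i} A_i(h_i)$ for $i \in I$, and $S_0 = \prod_{n \in \mathbf{D}_0} A_0(n)$ for nature; $S_{-i} = \prod_{j \in I^0\setminus\{i\}} S_j$. Under $s_i$, player $i \in I$ plays $s_i(h_i(n))$ at every node $n \in \mathbf{D}_i$ (even if $h_i(n)$ lies in a tree other than $T_n$); nature plays $s_0(n)$ at $n$. Mixed strategies: $\sigma_i \in \Delta(S_i)$. Behavior strategies of $i \in I$: $\beta_i \in B_i = \prod_{h_i \in H_i} \Delta(A_i(h_i))$; the mixed action at $n \in \mathbf{D}_i$ is $\beta_i(h_i(n))$ (actions outside $A_i(h_i(n))$ get probability $0$), with independent randomization across nodes. **Occurring.** A node $n \in \bar T$ of the upmost tree *occurs* with a pure profile $s$ if $n$ lies on the path in $\bar T$ that starts at the root of $\bar T$ and follows the actions prescribed by $s$ at each node of $\bar T$. A node $n \in T$, $T \in \mathbf{T}$, occurs with $s$ if the node $n' \in \bar T$ with $n'_T = n$ occurs with $s$. $o(n \mid \sigma_i, s_{-i})$ is the $\sigma_i$-probability of the set of $s_i$ such that $n$ occurs with $(s_i, s_{-i})$. $o(n \mid \beta_i, s_{-i})$ is the probability that $n$ occurs with $(\beta_i, s_{-i})$: with $n' \in \bar T$ the node such that $n'_{T_n} = n$, it is $0$ if at some node strictly preceding $n'$ in $\bar T$ the action prescribed by $s_{-i}$ for some active player other than $i$ is not the one leading towards $n'$, and otherwise is the product, over the nodes $n'' \in \mathbf{D}_i$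 strictly preceding $n'$ in $\bar T$, of $\beta_i(h_i(n''))(a)$, where $a$ is $i$'s action at $n''$ leading towards $n'$. *)

theory Defs
  imports "HOL-Probability.Probability"
begin

section \<open>Data\<close>

text \<open>A finite tree is given by its nodes and its strict (transitive) precedence relation.\<close>

definition rooted_tree :: "'n set \<Rightarrow> ('n \<Rightarrow> 'n \<Rightarrow> bool) \<Rightarrow> bool" where
  "rooted_tree N R \<longleftrightarrow>
     finite N \<and> irreflp_on N R \<and> transp_on N R \<and>
     (\<exists>r\<in>N. \<forall>x\<in>N. x \<noteq> r \<longrightarrow> R r x) \<and>
     (\<forall>z\<in>N. totalp_on {x \<in> N. R x z} R)"

text \<open>
  The type \<open>'i option\<close> adjoins nature (\<open>None\<close>) to the players; nature is absent when \<open>None\<close> is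
  active at no node. A subtree is identified with its set of nodes, and the copy of a node \<open>n\<close> in
  the tree \<open>T\<close> is the pair \<open>(T, n)\<close>, so that nodes of distinct trees are distinct objects.
\<close>

type_synonym 'n copy = "'n set \<times> 'n"

record ('i, 'n, 'a) game =
  players :: "'i set"
  dec_nodes :: "'n set"
  term_nodes :: "'n set"
  prec :: "'n \<Rightarrow> 'n \<Rightarrow> bool"
  active :: "'n \<Rightarrow> 'i option set"
  base_acts :: "'n \<Rightarrow> 'i option \<Rightarrow> 'a set"
  succ_of :: "'n \<Rightarrow> ('i option \<Rightarrow> 'a) \<Rightarrow> 'n"   \<comment> \<open>\<open>\<psi>\<^sub>n\<close>\<close>
  payoff :: "'i \<Rightarrow> 'n \<Rightarrow> real"
  trees :: "'n set set"
  tree_acts :: "'n set \<Rightarrow> 'n \<Rightarrow> 'i option \<Rightarrow> 'a set"   \<comment> \<open>\<open>A\<^sub>i\<^sup>T(n)\<close>\<close>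
  info :: "'i \<Rightarrow> 'n copy \<Rightarrow> 'n copy set"   \<comment> \<open>\<open>h\<^sub>i(n)\<close>\<close>

definition top_tree :: "('i, 'n, 'a) game \<Rightarrow> 'n set" where
  "top_tree G = dec_nodes G \<union> term_nodes G"

definition root :: "('i, 'n, 'a) game \<Rightarrow> 'n" where
  "root G = (THE r. r \<in> top_tree G \<and> (\<forall>x\<in>top_tree G. x \<noteq> r \<longrightarrow> prec G r x))"

definition succs :: "('i, 'n, 'a) game \<Rightarrow> 'n set \<Rightarrow> 'n \<Rightarrow> 'n set" where
  "succs G T x = {y \<in> T. prec G x y \<and> \<not> (\<exists>z\<in>T. prec G x z \<and> prec G z y)}"

definition nodes :: "('i, 'n, 'a) game \<Rightarrow> 'n copy set" where
  "nodes G = {(T, n). T \<in> trees G \<and> n \<in> T}"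

definition active_nodes :: "('i, 'n, 'a) game \<Rightarrow> 'i option \<Rightarrow> 'n copy set" where
  "active_nodes G j = {(T, n). T \<in> trees G \<and> n \<in> T \<and> n \<in> dec_nodes G \<and> j \<in> active G n}"

definition nodes_in :: "'n set \<Rightarrow> 'n copy set" where
  "nodes_in T = {T} \<times> T"

definition copies_in :: "'n set \<Rightarrow> 'n copy set \<Rightarrow> 'n copy set" where
  "copies_in T h = {(T, n) |n. n \<in> T \<and> n \<in> snd ` h}"

definition acts :: "('i, 'n, 'a) game \<Rightarrow> 'i option \<Rightarrow> 'n copy \<Rightarrow> 'a set" where
  "acts G j m = tree_acts G (fst m) (snd m) j"

definition dpath :: "('i, 'n, 'a) game \<Rightarrow> 'n set \<Rightarrow> 'n list \<Rightarrow> bool" where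
  "dpath G T p \<longleftrightarrow> p \<noteq> [] \<and> set p \<subseteq> T \<and> successively (\<lambda>x y. y \<in> succs G T x) p"

text \<open>Player \<open>j\<close> takes action \<open>a\<close> at the first node along the path \<open>p\<close> in \<open>T\<close>.\<close>

definition takes_first ::
    "('i, 'n, 'a) game \<Rightarrow> 'n set \<Rightarrow> 'i option \<Rightarrow> 'a \<Rightarrow> 'n list \<Rightarrow> bool" where
  "takes_first G T j a p \<longleftrightarrow>
     length p \<ge> 2 \<and> (T, hd p) \<in> active_nodes G j \<and>
     (\<exists>\<alpha> \<in> Pi\<^sub>E (active G (hd p)) (tree_acts G T (hd p)).
        p ! 1 = succ_of G (hd p) \<alpha> \<and> \<alpha> j = a)"


section \<open>Games of the extensive form with unawareness\<close>

locale base_game =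
  fixes G :: "('i, 'n, 'a) game"
  assumes finite_players: "finite (players G)"
    and base_tree: "rooted_tree (top_tree G) (prec G)"
    and dec_term_disjoint: "dec_nodes G \<inter> term_nodes G = {}"
    and dec_nonempty: "dec_nodes G \<noteq> {}"
    and active_nonempty: "n \<in> dec_nodes G \<Longrightarrow> active G n \<noteq> {}"
    and active_players: "n \<in> dec_nodes G \<Longrightarrow> active G n \<subseteq> insert None (Some ` players G)"
    and base_acts: "n \<in> dec_nodes G \<Longrightarrow> j \<in> active G n \<Longrightarrow>
          base_acts G n j \<noteq> {} \<and> finite (base_acts G n j)"
    and succ_of_bij: "n \<in> dec_nodes G \<Longrightarrow>
          bij_betw (succ_of G n) (Pi\<^sub>E (active G n) (base_acts G n)) (succs G (top_tree G) n)"
    and term_no_succs: "z \<in> term_nodes G \<Longrightarrow> succs G (top_tree G) z = {}"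

text \<open>
  In \<open>F3\<close> the action sets are those of the base tree; this follows from the variant with
  \<open>tree_acts G T\<close>, of which it is the instance \<open>T = top_tree G\<close>.
\<close>

locale game_forest = base_game G for G :: "('i, 'n, 'a) game" +
  assumes subtrees: "T \<in> trees G \<Longrightarrow>
          T \<subseteq> top_tree G \<and> T \<inter> dec_nodes G \<noteq> {} \<and> rooted_tree T (prec G)"
    and finite_trees: "finite (trees G)"
    and top_in_trees: "top_tree G \<in> trees G"
    and join: "T' \<in> trees G \<Longrightarrow> T'' \<in> trees G \<Longrightarrow>
          \<exists>J\<in>trees G. T' \<subseteq> J \<and> T'' \<subseteq> J \<and> (\<forall>U\<in>trees G. T' \<subseteq> U \<and> T'' \<subseteq> U \<longrightarrow> J \<subseteq> U)"
    and F0: "T \<in> trees G \<Longrightarrow> n \<in> T \<Longrightarrow> n'' \<in> T \<Longrightarrow> n' \<in> top_tree G \<Longrightarrow>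
          prec G n n' \<Longrightarrow> prec G n' n'' \<Longrightarrow> n' \<in> T"
    and F1: "T \<in> trees G \<Longrightarrow> n \<in> T \<Longrightarrow> succs G T n = {} \<Longrightarrow> n \<in> term_nodes G"
    and F2_acts: "T \<in> trees G \<Longrightarrow> n \<in> T \<Longrightarrow> n \<in> dec_nodes G \<Longrightarrow> j \<in> active G n \<Longrightarrow>
          tree_acts G T n j \<noteq> {} \<and> tree_acts G T n j \<subseteq> base_acts G n j"
    and F2_bij: "T \<in> trees G \<Longrightarrow> n \<in> T \<Longrightarrow> n \<in> dec_nodes G \<Longrightarrow>
          bij_betw (succ_of G n) (Pi\<^sub>E (active G n) (tree_acts G T n)) (succs G T n)"
    and F3: "T \<in> trees G \<Longrightarrow> n \<in> T \<Longrightarrow> n' \<in> T \<Longrightarrow> n \<in> dec_nodes G \<Longrightarrow> n' \<in> dec_nodes G \<Longrightarrow>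
          j \<in> active G n \<inter> active G n' \<Longrightarrow>
          base_acts G n j \<inter> base_acts G n' j \<noteq> {} \<Longrightarrow> base_acts G n j = base_acts G n' j"

locale unawareness_game = game_forest G for G :: "('i, 'n, 'a) game" +
  assumes info: "m \<in> active_nodes G (Some i) \<Longrightarrow>
          info G i m \<noteq> {} \<and> info G i m \<subseteq> active_nodes G (Some i)"
    and I2: "m \<in> active_nodes G (Some i) \<Longrightarrow> m' \<in> info G i m \<Longrightarrow> info G i m' = info G i m"
    and I3: "m \<in> active_nodes G (Some i) \<Longrightarrow> T' \<in> trees G \<Longrightarrow>
          (T', n') \<in> info G i m \<Longrightarrow> info G i m \<subseteq> nodes_in T' \<Longrightarrow>
          dpath G T' p \<Longrightarrow> hd p = n' \<Longrightarrow> last p = n'' \<Longrightarrow>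
          (T', n') \<in> active_nodes G (Some i) \<Longrightarrow> (T', n'') \<in> active_nodes G (Some i) \<Longrightarrow>
          info G i (T', n'') \<subseteq> nodes_in T'"
    and I4: "m \<in> active_nodes G (Some i) \<Longrightarrow> m' \<in> info G i m \<Longrightarrow>
          acts G (Some i) m' \<subseteq> acts G (Some i) m"
    and I5: "(T, n) \<in> active_nodes G (Some i) \<Longrightarrow> (T, n') \<in> active_nodes G (Some i) \<Longrightarrow>
          acts G (Some i) (T, n) = acts G (Some i) (T, n') \<Longrightarrow>
          info G i (T, n') = info G i (T, n)"
    and U0: "(T, n) \<in> active_nodes G (Some i) \<Longrightarrow>
          \<exists>T'\<in>trees G. T' \<subseteq> T \<and> info G i (T, n) \<subseteq> nodes_in T'"
    and U1: "(T, n) \<in> active_nodes G (Some i) \<Longrightarrow> T' \<in> trees G \<Longrightarrow>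
          info G i (T, n) \<subseteq> nodes_in T' \<Longrightarrow> n \<in> T' \<and> (T', n) \<in> info G i (T, n)"
    and U4: "T \<in> trees G \<Longrightarrow> T' \<in> trees G \<Longrightarrow> T \<subseteq> T' \<Longrightarrow> T' \<subseteq> T'' \<Longrightarrow>
          (T'', n) \<in> active_nodes G (Some i) \<Longrightarrow> info G i (T'', n) \<subseteq> nodes_in T \<Longrightarrow>
          n \<in> T' \<Longrightarrow> info G i (T', n) = info G i (T'', n)"
    and U5: "T \<in> trees G \<Longrightarrow> T' \<in> trees G \<Longrightarrow> T \<subseteq> T' \<Longrightarrow> T' \<subseteq> T'' \<Longrightarrow>
          (T'', n) \<in> active_nodes G (Some i) \<Longrightarrow> info G i (T'', n) \<subseteq> nodes_in T' \<Longrightarrow>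
          n \<in> T \<Longrightarrow> info G i (T, n) = copies_in T (info G i (T'', n))"

definition perfect_recall :: "('i, 'n, 'a) game \<Rightarrow> 'i \<Rightarrow> bool" where
  "perfect_recall G i \<longleftrightarrow>
     (\<forall>T n1 nk p a.
        (T, n1) \<in> active_nodes G (Some i) \<longrightarrow> (T, nk) \<in> active_nodes G (Some i) \<longrightarrow> n1 \<noteq> nk \<longrightarrow>
        dpath G T p \<longrightarrow> hd p = n1 \<longrightarrow> last p = nk \<longrightarrow> takes_first G T (Some i) a p \<longrightarrow>
        (\<forall>(T', n') \<in> info G i (T, nk).
           \<exists>n1' p'. n1' \<noteq> n' \<and> dpath G T' p' \<and> hd p' = n1' \<and> last p' = n' \<and>
             info G i (T', n1') = info G i (T, n1) \<and> takes_first G T' (Some i) a p'))"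


section \<open>Strategies\<close>

definition info_sets :: "('i, 'n, 'a) game \<Rightarrow> 'i \<Rightarrow> 'n copy set set" where
  "info_sets G i = info G i ` active_nodes G (Some i)"

text \<open>By \<open>I2\<close> and \<open>I4\<close>, all nodes of an information set have the same actions.\<close>

definition info_acts :: "('i, 'n, 'a) game \<Rightarrow> 'i \<Rightarrow> 'n copy set \<Rightarrow> 'a set" where
  "info_acts G i h = (THE B. \<forall>m\<in>h. acts G (Some i) m = B)"

definition strategies :: "('i, 'n, 'a) game \<Rightarrow> 'i \<Rightarrow> ('n copy set \<Rightarrow> 'a) set" where
  "strategies G i = Pi\<^sub>E (info_sets G i) (info_acts G i)"

definition nature_strategies :: "('i, 'n, 'a) game \<Rightarrow> ('n copy \<Rightarrow> 'a) set" where
  "nature_strategies G = Pi\<^sub>E (active_nodes G None) (acts G None)"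

text \<open>
  A profile pairs nature's strategy with the strategies of the players. In a profile against
  \<open>i\<close>, the component of \<open>i\<close> is \<open>undefined\<close>.
\<close>

type_synonym ('i, 'n, 'a) profile = "('n copy \<Rightarrow> 'a) \<times> ('i \<Rightarrow> 'n copy set \<Rightarrow> 'a)"

definition opponent_profiles :: "('i, 'n, 'a) game \<Rightarrow> 'i \<Rightarrow> ('i, 'n, 'a) profile set" where
  "opponent_profiles G i = nature_strategies G \<times> Pi\<^sub>E (players G - {i}) (strategies G)"

definition insert_strategy ::
    "'i \<Rightarrow> ('n copy set \<Rightarrow> 'a) \<Rightarrow> ('i, 'n, 'a) profile \<Rightarrow> ('i, 'n, 'a) profile" where
  "insert_strategy i si s = (fst s, (snd s)(i := si))"

definition mixed_strategies :: "('i, 'n, 'a) game \<Rightarrow> 'i \<Rightarrow> ('n copy set \<Rightarrow> 'a) pmf set" where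
  "mixed_strategies G i = {\<sigma>. set_pmf \<sigma> \<subseteq> strategies G i}"

definition behavior_strategies :: "('i, 'n, 'a) game \<Rightarrow> 'i \<Rightarrow> ('n copy set \<Rightarrow> 'a pmf) set" where
  "behavior_strategies G i = (\<Pi>\<^sub>E h\<in>info_sets G i. {\<mu>. set_pmf \<mu> \<subseteq> info_acts G i h})"


section \<open>Occurrence of nodes\<close>

definition prescribed :: "('i, 'n, 'a) game \<Rightarrow> ('i, 'n, 'a) profile \<Rightarrow> 'n copy \<Rightarrow> 'i option \<Rightarrow> 'a" where
  "prescribed G s m j = (case j of None \<Rightarrow> fst s m | Some k \<Rightarrow> snd s k (info G k m))"

inductive_set play :: "('i, 'n, 'a) game \<Rightarrow> ('i, 'n, 'a) profile \<Rightarrow> 'n set"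
  for G :: "('i, 'n, 'a) game" and s :: "('i, 'n, 'a) profile" where
  root: "root G \<in> play G s"
| step: "n \<in> play G s \<Longrightarrow> n \<in> dec_nodes G \<Longrightarrow>
    succ_of G n (restrict (prescribed G s (top_tree G, n)) (active G n)) \<in> play G s"

text \<open>The node of the upmost tree with copy \<open>m\<close> in \<open>fst m\<close> is \<open>snd m\<close>.\<close>

definition occurs :: "('i, 'n, 'a) game \<Rightarrow> ('i, 'n, 'a) profile \<Rightarrow> 'n copy \<Rightarrow> bool" where
  "occurs G s m \<longleftrightarrow> snd m \<in> play G s"

definition occ_mixed :: "('i, 'n, 'a) game \<Rightarrow> 'i \<Rightarrow> 'n copy \<Rightarrow>
    ('n copy set \<Rightarrow> 'a) pmf \<Rightarrow> ('i, 'n, 'a) profile \<Rightarrow> real" where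
  "occ_mixed G i m \<sigma> s =
     measure_pmf.prob \<sigma> {si \<in> strategies G i. occurs G (insert_strategy i si s) m}"

text \<open>The action of \<open>j\<close> at \<open>n\<close> in the upmost tree that leads towards the later node \<open>n'\<close>.\<close>

definition action_towards :: "('i, 'n, 'a) game \<Rightarrow> 'n \<Rightarrow> 'n \<Rightarrow> 'i option \<Rightarrow> 'a" where
  "action_towards G n n' =
     (THE \<alpha>. \<alpha> \<in> Pi\<^sub>E (active G n) (base_acts G n) \<and>
        (succ_of G n \<alpha> = n' \<or> prec G (succ_of G n \<alpha>) n'))"

definition preds :: "('i, 'n, 'a) game \<Rightarrow> 'n \<Rightarrow> 'n set" where
  "preds G n' = {n \<in> top_tree G. prec G n n'}"

definition occ_behavior :: "('i, 'n, 'a) game \<Rightarrow> 'i \<Rightarrow> 'n copy \<Rightarrow>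
    ('n copy set \<Rightarrow> 'a pmf) \<Rightarrow> ('i, 'n, 'a) profile \<Rightarrow> real" where
  "occ_behavior G i m \<beta> s =
     (if \<exists>n \<in> preds G (snd m). \<exists>j \<in> active G n - {Some i}.
           prescribed G s (top_tree G, n) j \<noteq> action_towards G n (snd m) j
      then 0
      else \<Prod>n \<in> {n \<in> preds G (snd m). (top_tree G, n) \<in> active_nodes G (Some i)}.
             pmf (\<beta> (info G i (top_tree G, n))) (action_towards G n (snd m) (Some i)))"

definition realization_equivalent :: "('i, 'n, 'a) game \<Rightarrow> 'i \<Rightarrow>
    ('n copy set \<Rightarrow> 'a) pmf \<Rightarrow> ('n copy set \<Rightarrow> 'a pmf) \<Rightarrow> bool" where
  "realization_equivalent G i \<sigma> \<beta> \<longleftrightarrow>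
     (\<forall>m \<in> nodes G. \<forall>s \<in> opponent_profiles G i. occ_mixed G i m \<sigma> s = occ_behavior G i m \<beta> s)"

end

theory Submission
  imports Defs
begin

text \<open>
  As in Kuhn's theorem, the behavior strategy at \<open>h\<close> is the \<open>\<sigma>\<close>-distribution of the action at \<open>h\<close>
  conditional on player \<open>i\<close> not having excluded \<open>h\<close>, and the product of these conditional
  probabilities along a path telescopes. Occurrence involves only nodes of the upmost tree, but
  their information sets may lie in lower trees. So what has to be shown is that two nodes of the
  upmost tree with the same information set are preceded by the same own information sets and
  actions.
\<close>

text \<open>A set meeting the support has nonzero measure, so \<open>cond_pmf\<close> is the
  normalised restriction of \<open>p\<close> to \<open>A\<close>.\<close>

lemma measure_cond_pmf:
  assumes "set_pmf p \<inter> A \<noteq> {}"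
  shows "measure_pmf.prob (cond_pmf p A) B = measure_pmf.prob p (A \<inter> B) / measure_pmf.prob p A"
  using emeasure_measure_pmf_not_zero[OF assms]
  by (simp add: cond_pmf.rep_eq[OF assms] measure_uniform_measure)

section \<open>The strict order of the upmost tree\<close>

context base_game
begin

abbreviation upmost :: "'n set" where "upmost \<equiv> top_tree G"

lemma finite_top: "finite upmost"
  using base_tree unfolding rooted_tree_def by blast

lemma prec_irrefl: "x \<in> upmost \<Longrightarrow> \<not> prec G x x"
  using base_tree unfolding rooted_tree_def irreflp_on_def by blast

lemma prec_trans:
  "\<lbrakk>prec G x y; prec G y z; x \<in> upmost; y \<in> upmost; z \<in> upmost\<rbrakk> \<Longrightarrow> prec G x z"
  using base_tree unfolding rooted_tree_def transp_on_def by blast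

lemma prec_total:
  "\<lbrakk>prec G x z; prec G y z; x \<in> upmost; y \<in> upmost; z \<in> upmost; x \<noteq> y\<rbrakk> \<Longrightarrow> prec G x y \<or> prec G y x"
  using base_tree unfolding rooted_tree_def totalp_on_def by blast

lemma finite_preds: "finite (preds G n)"
  using finite_top by (simp add: preds_def)

lemma preds_psubset:
  assumes "prec G x y" "x \<in> upmost" "y \<in> upmost"
  shows "preds G x \<subset> preds G y"
proof
  show "preds G x \<subseteq> preds G y"
    using assms prec_trans by (auto simp: preds_def)
  show "preds G x \<noteq> preds G y"
    using assms prec_irrefl by (auto simp: preds_def)
qed

text \<open>The number of predecessors acts as depth: it drives the induction and picks extremal
  nodes on chains.\<close>

lemma card_preds_less: "\<lbrakk>prec G x y; x \<in> upmost; y \<in> upmost\<rbrakk> \<Longrightarrow> card (preds G x) < card (preds G y)"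
  by (intro psubset_card_mono finite_preds preds_psubset)

lemma top_induct [consumes 1, case_names less]:
  assumes "n \<in> upmost"
    and "\<And>n. n \<in> upmost \<Longrightarrow> (\<And>m. m \<in> preds G n \<Longrightarrow> P m) \<Longrightarrow> P n"
  shows "P n"
  using assms(1)
proof (induction "card (preds G n)" arbitrary: n rule: less_induct)
  case less
  show ?case
  proof (rule assms(2)[OF less.prems])
    fix m assume "m \<in> preds G n"
    then show "P m"
      using less.hyps less.prems card_preds_less by (simp add: preds_def)
  qed
qed

text \<open>Predecessors of \<open>n\<close> form a chain, so an element of \<open>S\<close> of
  maximal depth comes after all the others.\<close>

lemma ex_last_pred:
  assumes "n \<in> upmost" "S \<subseteq> preds G n" "S \<noteq> {}"
  obtains m where "m \<in> S" "\<And>k. k \<in> S \<Longrightarrow> k = m \<or> prec G k m"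
proof -
  have "finite S"
    using assms(2) finite_preds finite_subset by blast
  then obtain m where m: "m \<in> S" "\<And>k. k \<in> S \<Longrightarrow> card (preds G k) \<le> card (preds G m)"
    using assms(3) arg_min_if_finite[of S "\<lambda>k. - int (card (preds G k))"]
    by (metis neg_less_iff_less not_le of_nat_less_iff)
  have "k = m \<or> prec G k m" if "k \<in> S" for k
  proof -
    have "k \<in> upmost" "m \<in> upmost" "prec G k n" "prec G m n"
      using that m(1) assms(2) by (auto simp: preds_def)
    then show ?thesis
      using prec_total[of k n m] card_preds_less[of m k] m(2)[OF that] assms(1) by linarith
  qed
  with m(1) show thesis by (rule that)
qed

lemma ex_succ_towards:
  assumes "m \<in> upmost" "n \<in> upmost" "prec G m n"
  obtains y where "y \<in> succs G upmost m" "y = n \<or> prec G y n"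
proof -
  \<comment> \<open>\<open>S\<close> is the segment of the chain after \<open>m\<close> up to and
    including \<open>n\<close>; its element of least depth is the successor sought.\<close>
  define S where "S = {x \<in> upmost. prec G m x \<and> (x = n \<or> prec G x n)}"
  have "finite S" "S \<noteq> {}"
    using assms finite_top by (auto simp: S_def)
  then obtain y where y: "y \<in> S" "\<And>x. x \<in> S \<Longrightarrow> card (preds G y) \<le> card (preds G x)"
    using arg_min_if_finite[of S "\<lambda>k. card (preds G k)"] by (metis not_le)
  have "\<not> prec G z y" if "z \<in> upmost" "prec G m z" for z
  proof
    assume zy: "prec G z y"
    have "z \<in> S"
      using that zy y(1) assms(2) prec_trans[of z y n] by (auto simp: S_def)
    then show False
      using y card_preds_less[OF zy] that by (fastforce simp: S_def)
  qed
  then show thesis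
    using y(1) by (intro that[of y]) (auto simp: S_def succs_def)
qed

text \<open>Both nodes lie on the chain ending in \<open>n\<close>; if they were distinct, one would
  lie strictly between \<open>m\<close> and the other.\<close>

lemma succ_towards_unique:
  assumes "n \<in> upmost" "y \<in> succs G upmost m" "y = n \<or> prec G y n"
    "y' \<in> succs G upmost m" "y' = n \<or> prec G y' n"
  shows "y = y'"
  using assms prec_total[of y n y'] by (auto simp: succs_def)

section \<open>Actions leading towards a later node\<close>

lemma dec_if_succs: "\<lbrakk>m \<in> upmost; y \<in> succs G upmost m\<rbrakk> \<Longrightarrow> m \<in> dec_nodes G"
  using term_no_succs by (auto simp: top_tree_def)

lemma dec_in_top: "m \<in> dec_nodes G \<Longrightarrow> m \<in> upmost"
  by (simp add: top_tree_def)

lemma dec_if_prec: "\<lbrakk>m \<in> upmost; n \<in> upmost; prec G m n\<rbrakk> \<Longrightarrow> m \<in> dec_nodes G"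
  using ex_succ_towards dec_if_succs by metis

lemma succ_of_in_succs:
  "\<lbrakk>m \<in> dec_nodes G; \<alpha> \<in> Pi\<^sub>E (active G m) (base_acts G m)\<rbrakk> \<Longrightarrow> succ_of G m \<alpha> \<in> succs G upmost m"
  using succ_of_bij bij_betwE by blast

text \<open>Justifies the definite description: the successor towards \<open>n\<close> is unique and
  \<open>succ_of\<close> is injective on action profiles.\<close>

lemma action_towards_eq:
  assumes "m \<in> dec_nodes G" "n \<in> upmost" "\<alpha> \<in> Pi\<^sub>E (active G m) (base_acts G m)"
    "succ_of G m \<alpha> = n \<or> prec G (succ_of G m \<alpha>) n"
  shows "action_towards G m n = \<alpha>"
  unfolding action_towards_def
proof (rule the_equality)
  fix \<alpha>' assume *: "\<alpha>' \<in> Pi\<^sub>E (active G m) (base_acts G m) \<and>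
    (succ_of G m \<alpha>' = n \<or> prec G (succ_of G m \<alpha>') n)"
  then have "succ_of G m \<alpha>' = succ_of G m \<alpha>"
    using succ_towards_unique[of n "succ_of G m \<alpha>'" m "succ_of G m \<alpha>"] assms succ_of_in_succs
    by blast
  with * assms(3) show "\<alpha>' = \<alpha>"
    using succ_of_bij[OF assms(1)] unfolding bij_betw_def inj_on_def by blast
qed (use assms in auto)

lemma action_towards:
  assumes "m \<in> upmost" "n \<in> upmost" "prec G m n"
  shows "action_towards G m n \<in> Pi\<^sub>E (active G m) (base_acts G m)"
    and "succ_of G m (action_towards G m n) = n \<or> prec G (succ_of G m (action_towards G m n)) n"
proof -
  obtain y where y: "y \<in> succs G upmost m" "y = n \<or> prec G y n"
    using ex_succ_towards assms by metis
  have dec: "m \<in> dec_nodes G"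
    using dec_if_prec assms by blast
  obtain \<alpha> where \<alpha>: "\<alpha> \<in> Pi\<^sub>E (active G m) (base_acts G m)" "y = succ_of G m \<alpha>"
    using y(1) succ_of_bij[OF dec] unfolding bij_betw_def by blast
  have "action_towards G m n = \<alpha>"
    using action_towards_eq dec assms(2) \<alpha> y(2) by blast
  with \<alpha> y(2) show "action_towards G m n \<in> Pi\<^sub>E (active G m) (base_acts G m)"
    "succ_of G m (action_towards G m n) = n \<or> prec G (succ_of G m (action_towards G m n)) n"
    by auto
qed

text \<open>By transitivity, the profile at \<open>k\<close> leading towards \<open>m\<close> also
  leads towards \<open>n\<close>. Conditions on moves before \<open>m\<close> therefore read the
  same for both targets.\<close>

lemma action_towards_mono:
  assumes "k \<in> upmost" "m \<in> upmost" "n \<in> upmost" "prec G k m" "prec G m n"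
  shows "action_towards G k n = action_towards G k m"
proof (rule action_towards_eq)
  show "k \<in> dec_nodes G"
    using dec_if_prec assms by blast
  note act = action_towards[OF assms(1,2,4)]
  show "action_towards G k m \<in> Pi\<^sub>E (active G k) (base_acts G k)"
    by (fact act)
  have "succ_of G k (action_towards G k m) \<in> upmost"
    using succ_of_in_succs[OF \<open>k \<in> dec_nodes G\<close> act(1)] by (simp add: succs_def)
  then show "succ_of G k (action_towards G k m) = n \<or> prec G (succ_of G k (action_towards G k m)) n"
    using act(2) assms prec_trans[of _ m n] by metis
qed (fact assms)

section \<open>Immediate successors and directed paths\<close>

lemma last_pred_succ:
  assumes "n \<in> upmost" "m \<in> preds G n" "\<And>k. k \<in> preds G n \<Longrightarrow> k = m \<or> prec G k m"
  shows "n \<in> succs G upmost m"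
proof -
  have m: "m \<in> upmost" "prec G m n"
    using assms(2) by (auto simp: preds_def)
  have "\<not> (prec G m z \<and> prec G z n)" if "z \<in> upmost" for z
    using that assms(3)[of z] m prec_irrefl[of m] prec_trans[of m z m] by (auto simp: preds_def)
  then show ?thesis
    using assms(1) m by (auto simp: succs_def)
qed

lemma preds_succ:
  assumes "m \<in> upmost" "n \<in> succs G upmost m"
  shows "preds G n = insert m (preds G m)"
  using assms prec_total[of _ n m] prec_trans[of _ m n] unfolding preds_def succs_def by blast

text \<open>Perfect recall speaks of paths, the rest of the proof of precedence. The path arises by
  appending \<open>n\<close> to one that ends in its last predecessor.\<close>

lemma ex_dpath:
  assumes "n \<in> upmost" "m \<in> preds G n"
  obtains p where "dpath G upmost p" "hd p = m" "last p = n" "length p \<ge> 2"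
proof -
  have "\<exists>p. dpath G upmost p \<and> hd p = m \<and> last p = n \<and> length p \<ge> 2"
    using assms
  proof (induction n rule: top_induct)
    case (less n)
    obtain q where q: "q \<in> preds G n" "\<And>k. k \<in> preds G n \<Longrightarrow> k = q \<or> prec G k q"
      using ex_last_pred[of n "preds G n"] less.hyps less.prems by blast
    have nq: "n \<in> succs G upmost q"
      using last_pred_succ less.hyps q by blast
    have upmost: "m \<in> upmost" "q \<in> upmost"
      using q less.prems by (auto simp: preds_def)
    show ?case
    proof (cases "m = q")
      case True
      then show ?thesis
        using nq upmost less.hyps by (intro exI[of _ "[m, n]"]) (simp add: dpath_def)
    next
      case False
      then have "m \<in> preds G q"
        using q(2)[OF less.prems] upmost by (simp add: preds_def)
      then obtain p where "dpath G upmost p" "hd p = m" "last p = q" "length p \<ge> 2"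
        using less.IH q(1) by blast
      then show ?thesis
        using nq less.hyps
        by (intro exI[of _ "p @ [n]"]) (auto simp: dpath_def successively_append_iff)
    qed
  qed
  then show thesis using that by blast
qed

lemma dpath_prec:
  assumes "dpath G T p" "T \<subseteq> upmost"
  shows "hd p = last p \<or> prec G (hd p) (last p)"
  using assms(1)
proof (induction p rule: induct_list012)
  case (3 x y zs)
  then have "hd (y # zs) = last (y # zs) \<or> prec G (hd (y # zs)) (last (y # zs))"
    by (simp add: dpath_def)
  moreover have "prec G x y" "x \<in> upmost" "y \<in> upmost" "last (y # zs) \<in> upmost"
    using 3(3) assms(2) last_in_set[of "y # zs"] by (auto simp: dpath_def succs_def)
  ultimately show ?case
    using prec_trans[of x y "last (y # zs)"] by auto
qed (auto simp: dpath_def)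

text \<open>Turns a path back into precedence; the second node identifies the action taken at the
  first. \<open>T\<close> is arbitrary because recall returns paths in lower trees.\<close>

lemma dpath_second:
  assumes "dpath G T p" "T \<subseteq> upmost" "length p \<ge> 2"
  shows "p ! 1 \<in> succs G T (hd p)" "p ! 1 = last p \<or> prec G (p ! 1) (last p)" "prec G (hd p) (last p)"
proof -
  obtain x y zs where p: "p = x # y # zs"
    using assms(3) by (metis One_nat_def Suc_1 Suc_le_length_iff)
  have "dpath G T (y # zs)"
    using assms(1) by (simp add: p dpath_def)
  from dpath_prec[OF this assms(2)] show 2: "p ! 1 = last p \<or> prec G (p ! 1) (last p)"
    by (simp add: p)
  show 1: "p ! 1 \<in> succs G T (hd p)"
    using assms(1) by (simp add: p dpath_def)
  have "hd p \<in> upmost" "p ! 1 \<in> upmost" "last p \<in> upmost"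
    using assms(1,2) last_in_set[of p] by (auto simp: p dpath_def)
  with 1 2 show "prec G (hd p) (last p)"
    using prec_trans[of "hd p" "p ! 1" "last p"] by (auto simp: succs_def)
qed

section \<open>The root and the path of play\<close>

lemma root_eqI:
  assumes "r \<in> upmost" "preds G r = {}"
  shows "r = root G"
proof -
  obtain r' where r': "r' \<in> upmost" "\<forall>x\<in>upmost. x \<noteq> r' \<longrightarrow> prec G r' x"
    using base_tree unfolding rooted_tree_def by blast
  with assms have "r' = r"
    by (auto simp: preds_def)
  have "root G = r"
    unfolding root_def
  proof (rule the_equality)
    show "r \<in> upmost \<and> (\<forall>x\<in>upmost. x \<noteq> r \<longrightarrow> prec G r x)"
      using r' \<open>r' = r\<close> by simp
  next
    fix x assume "x \<in> upmost \<and> (\<forall>y\<in>upmost. y \<noteq> x \<longrightarrow> prec G x y)"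
    then show "x = r"
      using assms by (auto simp: preds_def)
  qed
  then show ?thesis ..
qed

lemma root_no_preds: "root G \<in> upmost" "preds G (root G) = {}"
proof -
  obtain r where r: "r \<in> upmost" "\<forall>x\<in>upmost. x \<noteq> r \<longrightarrow> prec G r x"
    using base_tree unfolding rooted_tree_def by blast
  then have "\<not> prec G x r" if "x \<in> upmost" for x
    using that prec_irrefl[of r] prec_trans[of r x r] by metis
  then have "preds G r = {}"
    by (simp add: preds_def)
  with root_eqI r(1) show "root G \<in> upmost" "preds G (root G) = {}"
    by auto
qed

text \<open>By induction the play reaches the last predecessor \<open>q\<close> of \<open>n\<close>,
  and the profile prescribed there leads to \<open>n\<close>.\<close>

lemma play_if_prescribed:
  assumes "n \<in> upmost"
    and "\<forall>m\<in>preds G n. \<forall>j\<in>active G m. prescribed G s (upmost, m) j = action_towards G m n j"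
  shows "n \<in> play G s"
  using assms
proof (induction n rule: top_induct)
  case (less n)
  show ?case
  proof (cases "preds G n = {}")
    case True
    then show ?thesis
      using root_eqI less.hyps play.root by metis
  next
    case False
    then obtain q where q: "q \<in> preds G n" "\<And>k. k \<in> preds G n \<Longrightarrow> k = q \<or> prec G k q"
      using ex_last_pred[of n "preds G n"] less.hyps by blast
    have nq: "n \<in> succs G upmost q"
      using last_pred_succ less.hyps q by blast
    have qn: "q \<in> upmost" "prec G q n"
      using q(1) by (auto simp: preds_def)
    have qdec: "q \<in> dec_nodes G"
      using dec_if_succs nq qn by blast
    note act = action_towards[OF qn(1) less.hyps qn(2)]
    \<comment> \<open>\<open>n\<close> is itself an immediate successor of \<open>q\<close>, which
      excludes a successor strictly before \<open>n\<close>.\<close>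
    have "succ_of G q (action_towards G q n) = n"
      using succ_towards_unique[OF less.hyps succ_of_in_succs[OF qdec act(1)] act(2) nq] by simp
    \<comment> \<open>Off \<open>active G q\<close> both sides are \<open>undefined\<close>.\<close>
    moreover have "restrict (prescribed G s (upmost, q)) (active G q) = action_towards G q n"
      using act(1) less.prems q(1) by (intro ext) (auto simp: restrict_def PiE_def extensional_def)
    moreover have "q \<in> play G s"
    proof (rule less.IH[OF q(1)], intro ballI)
      fix m j assume mj: "m \<in> preds G q" "j \<in> active G m"
      then have "m \<in> preds G n"
        using preds_succ[OF qn(1) nq] by simp
      moreover have "action_towards G m n = action_towards G m q"
        using action_towards_mono mj(1) qn less.hyps by (simp add: preds_def)
      ultimately show "prescribed G s (upmost, m) j = action_towards G m q j"
        using less.prems mj(2) by simp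
    qed
    ultimately show ?thesis
      using play.step[of q G s] qdec by simp
  qed
qed

text \<open>Feasibility keeps each profile in the domain where \<open>succ_of\<close> yields an
  immediate successor, so a step of play adds exactly the current node to the predecessors.\<close>

lemma prescribed_if_play:
  assumes "n \<in> play G s"
    and feasible: "\<And>m j. m \<in> dec_nodes G \<Longrightarrow> j \<in> active G m \<Longrightarrow>
      prescribed G s (upmost, m) j \<in> base_acts G m j"
  shows "n \<in> upmost \<and>
    (\<forall>m\<in>preds G n. \<forall>j\<in>active G m. prescribed G s (upmost, m) j = action_towards G m n j)"
  using assms(1)
proof induction
  case root
  then show ?case by (simp add: root_no_preds)
next
  case (step n)
  define \<alpha> where "\<alpha> = restrict (prescribed G s (upmost, n)) (active G n)"
  define n' where "n' = succ_of G n \<alpha>"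
  have \<alpha>: "\<alpha> \<in> Pi\<^sub>E (active G n) (base_acts G n)"
    using feasible step.hyps by (simp add: \<alpha>_def)
  have succ: "n' \<in> succs G upmost n"
    unfolding n'_def by (intro succ_of_in_succs step.hyps \<alpha>)
  then have n': "n' \<in> upmost" "prec G n n'"
    by (auto simp: succs_def)
  have at: "action_towards G n n' = \<alpha>"
    using action_towards_eq step.hyps n'(1) \<alpha> n'_def by blast
  have "prescribed G s (upmost, m) j = action_towards G m n' j"
    if "m \<in> preds G n'" "j \<in> active G m" for m j
  proof (cases "m = n")
    case True
    then show ?thesis
      using at that(2) by (simp add: \<alpha>_def)
  next
    case False
    then have m: "m \<in> preds G n"
      using that(1) preds_succ succ step.IH by blast
    then have "action_towards G m n' = action_towards G m n"
      using action_towards_mono step.IH n' by (simp add: preds_def)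
    then show ?thesis
      using m that(2) step.IH by simp
  qed
  with n' show ?case
    by (simp add: n'_def \<alpha>_def)
qed

end

section \<open>Feasible actions across the forest\<close>

context unawareness_game
begin

lemma node_in_upmost: "m \<in> nodes G \<Longrightarrow> snd m \<in> upmost"
  using subtrees by (fastforce simp: nodes_def)

lemma tree_acts_profile:
  assumes "T \<in> trees G" "n \<in> T" "n \<in> dec_nodes G" "\<alpha> \<in> Pi\<^sub>E (active G n) (tree_acts G T n)"
  shows "\<alpha> \<in> Pi\<^sub>E (active G n) (base_acts G n)"
proof -
  have "Pi\<^sub>E (active G n) (tree_acts G T n) \<subseteq> Pi\<^sub>E (active G n) (base_acts G n)"
    using F2_acts[OF assms(1-3)] by (intro PiE_mono) blast
  then show ?thesis
    using assms(4) by blast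
qed

text \<open>\<open>I2\<close> makes \<open>I4\<close> applicable in both directions between two
  nodes of the set, so their action sets agree and the definite description is well defined.\<close>

lemma info_acts_eq:
  assumes "m \<in> active_nodes G (Some k)" "m' \<in> info G k m"
  shows "info_acts G k (info G k m) = acts G (Some k) m'"
proof -
  have eq: "acts G (Some k) m1 = acts G (Some k) m2"
    if "m1 \<in> info G k m" "m2 \<in> info G k m" for m1 m2
  proof -
    have "m1 \<in> active_nodes G (Some k)" "m2 \<in> active_nodes G (Some k)"
      "info G k m1 = info G k m" "info G k m2 = info G k m"
      using info[OF assms(1)] I2[OF assms(1)] that by blast+
    with that show ?thesis
      using I4 by (metis subset_antisym)
  qed
  show ?thesis
    unfolding info_acts_def using eq assms(2) by (intro the_equality) blast+
qed

text \<open>The claim is an inclusion because \<open>m\<close> need not belong to its own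
  information set, which may lie in a lower tree.\<close>

lemma info_acts_subset:
  assumes "m \<in> active_nodes G (Some k)"
  shows "info_acts G k (info G k m) \<subseteq> acts G (Some k) m"
  using info[OF assms] info_acts_eq[OF assms] I4[OF assms] by blast

lemma prescribed_feasible:
  assumes "fst s \<in> nature_strategies G"
    and "\<And>k. k \<in> players G \<Longrightarrow> snd s k \<in> strategies G k"
    and m: "m \<in> dec_nodes G" "j \<in> active G m"
  shows "prescribed G s (upmost, m) j \<in> base_acts G m j"
proof -
  have act: "(upmost, m) \<in> active_nodes G j"
    using m top_in_trees dec_in_top by (simp add: active_nodes_def)
  have "prescribed G s (upmost, m) j \<in> acts G j (upmost, m)"
  proof (cases j)
    case None
    then show ?thesis
      using assms(1) act by (auto simp: prescribed_def nature_strategies_def)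
  next
    case (Some k)
    then have "snd s k \<in> strategies G k"
      using active_players m assms(2) by blast
    then have "snd s k (info G k (upmost, m)) \<in> info_acts G k (info G k (upmost, m))"
      using act Some by (auto simp: strategies_def info_sets_def)
    then show ?thesis
      using info_acts_subset act Some by (auto simp: prescribed_def)
  qed
  then show ?thesis
    using F2_acts[OF top_in_trees dec_in_top] m by (auto simp: acts_def)
qed

text \<open>
  By \<open>U0\<close> and \<open>U1\<close>, the information set of \<open>n\<close> and \<open>n'\<close> lies in a tree \<open>T\<close> containing copies of
  both. Perfect recall yields \<open>m'\<close> with the right information set in \<open>T\<close>. Applied a second time,
  from \<open>n'\<close> back to \<open>n\<close>, it shows that the information set of \<open>m'\<close> in the upmost tree also lies
  below \<open>T\<close>, so by \<open>U4\<close> it is the same as that of the copy of \<open>m'\<close> in \<open>T\<close>.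
\<close>

lemma perfect_recall_top:
  assumes recall: "perfect_recall G i"
    and n: "(upmost, n) \<in> active_nodes G (Some i)" and n': "(upmost, n') \<in> active_nodes G (Some i)"
    and same: "info G i (upmost, n) = info G i (upmost, n')"
    and m: "m \<in> preds G n" "(upmost, m) \<in> active_nodes G (Some i)"
  obtains m' where "m' \<in> preds G n'" "(upmost, m') \<in> active_nodes G (Some i)"
    "info G i (upmost, m') = info G i (upmost, m)"
    "action_towards G m' n' (Some i) = action_towards G m n (Some i)"
proof -
  obtain T where T: "T \<in> trees G" "T \<subseteq> upmost" "info G i (upmost, n) \<subseteq> nodes_in T"
    using U0[OF n] by blast
  have copies: "(T, n) \<in> info G i (upmost, n)" "(T, n') \<in> info G i (upmost, n)"
    using U1[OF n T(1,3)] U1[OF n' T(1)] T(3) same by auto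
  \<comment> \<open>\<open>x\<close> and \<open>y\<close> are kept general because the claim serves
    twice, once from \<open>n\<close> to \<open>n'\<close> and once from \<open>n'\<close> to
    \<open>n\<close>.\<close>
  have transfer: "\<exists>m'. m' \<in> T \<and> m' \<in> preds G y \<and> (T, m') \<in> active_nodes G (Some i) \<and>
      info G i (T, m') = info G i (upmost, l) \<and>
      action_towards G m' y (Some i) = action_towards G l x (Some i)"
    if x: "(upmost, x) \<in> active_nodes G (Some i)" and y: "(T, y) \<in> info G i (upmost, x)"
      and l: "l \<in> preds G x" "(upmost, l) \<in> active_nodes G (Some i)" for x y l
  proof -
    have xtop: "x \<in> upmost" and lx: "prec G l x" and ltop: "l \<in> upmost"
      and ldec: "l \<in> dec_nodes G"
      using x l by (auto simp: active_nodes_def preds_def)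
    have "l \<noteq> x"
      using lx ltop prec_irrefl by blast
    obtain p where p: "dpath G upmost p" "hd p = l" "last p = x" "length p \<ge> 2"
      using ex_dpath xtop l(1) by blast
    have "p ! 1 \<in> succs G upmost l"
      using dpath_second(1)[OF p(1) _ p(4)] p(2) by simp
    then obtain \<alpha> where \<alpha>: "\<alpha> \<in> Pi\<^sub>E (active G l) (tree_acts G upmost l)" "p ! 1 = succ_of G l \<alpha>"
      using F2_bij[OF top_in_trees ltop ldec] unfolding bij_betw_def by blast
    have base: "\<alpha> \<in> Pi\<^sub>E (active G l) (base_acts G l)"
      using top_in_trees ltop ldec \<alpha>(1) by (rule tree_acts_profile)
    have "succ_of G l \<alpha> = x \<or> prec G (succ_of G l \<alpha>) x"
      using dpath_second(2)[OF p(1) _ p(4)] p(3) \<alpha>(2) by simp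
    then have at: "action_towards G l x = \<alpha>"
      by (intro action_towards_eq ldec xtop base)
    have "takes_first G upmost (Some i) (\<alpha> (Some i)) p"
      unfolding takes_first_def p(2) by (intro conjI bexI[of _ \<alpha>] p(4) l(2) \<alpha> refl)
    \<comment> \<open>Recall is fed the path \<open>p\<close> in the upmost tree and read off at the
      copy of \<open>y\<close> in \<open>T\<close>.\<close>
    note recall[unfolded perfect_recall_def, THEN spec, THEN spec, THEN spec, THEN spec, THEN spec,
        THEN mp, THEN mp, THEN mp, THEN mp, THEN mp, THEN mp, THEN mp,
        OF l(2) x \<open>l \<noteq> x\<close> p(1-3) this]
    from bspec[OF this y] obtain m' q where q: "dpath G T q" "hd q = m'" "last q = y"
        "info G i (T, m') = info G i (upmost, l)" "takes_first G T (Some i) (\<alpha> (Some i)) q"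
      by blast
    have m'act: "(T, m') \<in> active_nodes G (Some i)" and len: "length q \<ge> 2"
      using q(5) unfolding takes_first_def q(2) by blast+
    have m'T: "m' \<in> T" "m' \<in> dec_nodes G"
      using m'act by (auto simp: active_nodes_def)
    have y_top: "y \<in> upmost"
      using info[OF x] y T(2) by (auto simp: active_nodes_def)
    obtain \<gamma> where \<gamma>: "\<gamma> \<in> Pi\<^sub>E (active G m') (tree_acts G T m')"
        "q ! 1 = succ_of G m' \<gamma>" "\<gamma> (Some i) = \<alpha> (Some i)"
      using q(5) unfolding takes_first_def q(2) by blast
    have base': "\<gamma> \<in> Pi\<^sub>E (active G m') (base_acts G m')"
      using T(1) m'T \<gamma>(1) by (rule tree_acts_profile)
    have "succ_of G m' \<gamma> = y \<or> prec G (succ_of G m' \<gamma>) y"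
      using dpath_second(2)[OF q(1) T(2) len] q(3) \<gamma>(2) by simp
    then have "action_towards G m' y = \<gamma>"
      by (intro action_towards_eq m'T y_top base')
    moreover have "m' \<in> preds G y"
      using dpath_second(3)[OF q(1) T(2) len] q(2,3) m'T T(2) by (auto simp: preds_def)
    ultimately show ?thesis
      using m'T m'act q(4) \<gamma>(3) at by auto
  qed
  obtain m' where m': "m' \<in> T" "m' \<in> preds G n'" "(T, m') \<in> active_nodes G (Some i)"
      "info G i (T, m') = info G i (upmost, m)"
      "action_towards G m' n' (Some i) = action_towards G m n (Some i)"
    using transfer[OF n copies(2) m] by blast
  have m'_act: "(upmost, m') \<in> active_nodes G (Some i)"
    using m'(1,3) T(2) top_in_trees by (auto simp: active_nodes_def)
  obtain m'' where m'': "(T, m'') \<in> active_nodes G (Some i)"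
      "info G i (T, m'') = info G i (upmost, m')"
    using transfer[OF n' _ m'(2) m'_act, of n] copies(1) same by auto
  \<comment> \<open>Applying \<open>U0\<close> at \<open>m''\<close> in \<open>T\<close>, not at
    \<open>m'\<close> in the upmost tree, places \<open>U\<close> below \<open>T\<close>, as
    \<open>U4\<close> requires.\<close>
  obtain U where U: "U \<in> trees G" "U \<subseteq> T" "info G i (upmost, m') \<subseteq> nodes_in U"
    using U0[OF m''(1)] m''(2) by auto
  have "info G i (T, m') = info G i (upmost, m')"
    by (rule U4[OF U(1) T(1) U(2) T(2) m'_act U(3) m'(1)])
  with m' m'_act show thesis
    using that by metis
qed

section \<open>Consistent strategies and the conditional behavior strategy\<close>

definition own_preds :: "'i \<Rightarrow> 'n \<Rightarrow> 'n set" where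
  "own_preds i n = {m \<in> preds G n. (upmost, m) \<in> active_nodes G (Some i)}"

text \<open>The event that \<open>i\<close> does not exclude \<open>n\<close> by own choices. It
  contains arbitrary functions; the support of \<sigma> later confines them to
  \<open>strategies G i\<close>.\<close>

definition consistent :: "'i \<Rightarrow> 'n \<Rightarrow> ('n copy set \<Rightarrow> 'a) set" where
  "consistent i n =
     {s. \<forall>m\<in>own_preds i n. s (info G i (upmost, m)) = action_towards G m n (Some i)}"

text \<open>Recall matches each own condition on the way to one node with one on the way to the
  other that has the same information set and action. The roles are symmetric.\<close>

lemma consistent_cong:
  assumes "perfect_recall G i"
    and "(upmost, n) \<in> active_nodes G (Some i)" "(upmost, n') \<in> active_nodes G (Some i)"
    and "info G i (upmost, n) = info G i (upmost, n')"
  shows "consistent i n = consistent i n'"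
proof -
  have sub: "consistent i y \<subseteq> consistent i x"
    if "(upmost, x) \<in> active_nodes G (Some i)" "(upmost, y) \<in> active_nodes G (Some i)"
      "info G i (upmost, x) = info G i (upmost, y)" for x y
  proof
    fix s assume s: "s \<in> consistent i y"
    have "s (info G i (upmost, m)) = action_towards G m x (Some i)" if "m \<in> own_preds i x" for m
      using perfect_recall_top[OF assms(1) \<open>(upmost, x) \<in> _\<close> \<open>(upmost, y) \<in> _\<close> \<open>info G i (upmost, x) = _\<close>, of m]
        that s unfolding consistent_def own_preds_def by (smt (verit) mem_Collect_eq)
    then show "s \<in> consistent i x"
      by (simp add: consistent_def)
  qed
  show ?thesis
    using sub assms(2-4) by (metis subset_antisym)
qed

text \<open>This is \<open>UNIV\<close> when \<open>h\<close> is not the information set of any node of the upmost tree.\<close>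

definition consistent_at :: "'i \<Rightarrow> 'n copy set \<Rightarrow> ('n copy set \<Rightarrow> 'a) set" where
  "consistent_at i h =
     (\<Inter>n\<in>{n. (upmost, n) \<in> active_nodes G (Some i) \<and> info G i (upmost, n) = h}. consistent i n)"

text \<open>The intersection runs over equal sets, so the conditioning event depends on the
  information set alone and can be computed at any of its upmost nodes.\<close>

lemma consistent_at_info:
  assumes "perfect_recall G i" "(upmost, n) \<in> active_nodes G (Some i)"
  shows "consistent_at i (info G i (upmost, n)) = consistent i n"
  unfolding consistent_at_def
proof (rule INF_eq_const)
  fix k assume "k \<in> {k. (upmost, k) \<in> active_nodes G (Some i) \<and>
    info G i (upmost, k) = info G i (upmost, n)}"
  then show "consistent i k = consistent i n"
    using consistent_cong[OF assms(1) _ assms(2)] by simp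
qed (use assms(2) in blast)

text \<open>\<open>cond_pmf\<close> is meaningful only when the event meets the support. Otherwise
  \<sigma> itself is the default, whose choices at \<open>h\<close> are feasible for a mixed
  strategy.\<close>

definition conditional_strategy ::
    "'i \<Rightarrow> ('n copy set \<Rightarrow> 'a) pmf \<Rightarrow> 'n copy set \<Rightarrow> 'a pmf" where
  "conditional_strategy i \<sigma> = (\<lambda>h\<in>info_sets G i. map_pmf (\<lambda>s. s h)
     (if set_pmf \<sigma> \<inter> consistent_at i h = {} then \<sigma> else cond_pmf \<sigma> (consistent_at i h)))"

lemma conditional_strategy_behavior:
  assumes "\<sigma> \<in> mixed_strategies G i"
  shows "conditional_strategy i \<sigma> \<in> behavior_strategies G i"
proof -
  have "s h \<in> info_acts G i h" if "s \<in> set_pmf \<sigma>" "h \<in> info_sets G i" for s h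
    using assms that by (auto simp: mixed_strategies_def strategies_def)
  then show ?thesis
    unfolding behavior_strategies_def conditional_strategy_def
    by (intro restrict_PiE_iff[THEN iffD2] ballI) (auto simp: set_cond_pmf)
qed

text \<open>The conditional probability is multiplied out so that the identity also covers an event
  of probability zero, where both sides vanish.\<close>

lemma pmf_conditional_strategy:
  assumes "perfect_recall G i" "(upmost, n) \<in> active_nodes G (Some i)"
  defines "h \<equiv> info G i (upmost, n)"
  shows "measure_pmf.prob \<sigma> (consistent i n) * pmf (conditional_strategy i \<sigma> h) a =
    measure_pmf.prob \<sigma> (consistent i n \<inter> {s. s h = a})"
proof (cases "set_pmf \<sigma> \<inter> consistent i n = {}")
  case True
  then have "measure_pmf.prob \<sigma> (consistent i n) = 0"
    "measure_pmf.prob \<sigma> (consistent i n \<inter> {s. s h = a}) = 0"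
    by (auto simp: measure_pmf_zero_iff)
  then show ?thesis by simp
next
  case False
  have "h \<in> info_sets G i"
    using assms(2) by (simp add: h_def info_sets_def)
  then have "pmf (conditional_strategy i \<sigma> h) a =
      measure_pmf.prob (cond_pmf \<sigma> (consistent i n)) {s. s h = a}"
    using False consistent_at_info[OF assms(1,2)]
    by (simp add: conditional_strategy_def h_def pmf_map vimage_def)
  then show ?thesis
    using False by (simp add: measure_measure_pmf_not_zero measure_cond_pmf Int_commute)
qed

text \<open>The product telescopes: the factor at the last own node \<open>q\<close> turns the
  probability of \<open>consistent i q\<close> into that of \<open>consistent i n\<close>.\<close>

lemma prod_conditional_strategy:
  assumes "perfect_recall G i" "n \<in> upmost"
  shows "(\<Prod>m\<in>own_preds i n. pmf (conditional_strategy i \<sigma> (info G i (upmost, m)))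
      (action_towards G m n (Some i))) = measure_pmf.prob \<sigma> (consistent i n)"
  using assms(2)
proof (induction n rule: top_induct)
  case (less n)
  show ?case
  proof (cases "own_preds i n = {}")
    case True
    \<comment> \<open>The product is empty and \<open>consistent i n\<close> is the whole space, so
      both sides are 1.\<close>
    then show ?thesis by (simp add: consistent_def)
  next
    case False
    \<comment> \<open>\<open>q\<close> is the last node before \<open>n\<close> at which
      \<open>i\<close> moves; nodes in between where only others move contribute no factor.\<close>
    then obtain q where q: "q \<in> own_preds i n" "\<And>k. k \<in> own_preds i n \<Longrightarrow> k = q \<or> prec G k q"
      using ex_last_pred[of n "own_preds i n"] less.hyps unfolding own_preds_def by blast
    have qn: "q \<in> preds G n" "q \<in> upmost" "prec G q n" "(upmost, q) \<in> active_nodes G (Some i)"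
      using q(1) by (auto simp: own_preds_def preds_def)
    have own: "own_preds i n = insert q (own_preds i q)"
      using q qn less.hyps prec_trans[of _ q n] by (auto simp: own_preds_def preds_def)
    have notin: "q \<notin> own_preds i q" "finite (own_preds i q)"
      using prec_irrefl[OF qn(2)] by (simp_all add: own_preds_def finite_preds) (simp add: preds_def)
    have act: "action_towards G m n = action_towards G m q" if "m \<in> own_preds i q" for m
      using action_towards_mono that qn less.hyps by (simp add: own_preds_def preds_def)
    have "consistent i n =
        consistent i q \<inter> {s. s (info G i (upmost, q)) = action_towards G q n (Some i)}"
      using act by (auto simp: consistent_def own)
    moreover note less.IH[OF qn(1)] pmf_conditional_strategy[OF assms(1) qn(4), of \<sigma>]
    ultimately show ?thesis
      using notin act by (simp add: own mult.commute)
  qed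
qed

section \<open>Occurrence and realization equivalence\<close>

lemma occurs_iff:
  assumes "si \<in> strategies G i" "s \<in> opponent_profiles G i" "m \<in> nodes G"
  shows "occurs G (insert_strategy i si s) m \<longleftrightarrow>
    (\<forall>n\<in>preds G (snd m). \<forall>j\<in>active G n - {Some i}.
       prescribed G s (upmost, n) j = action_towards G n (snd m) j) \<and> si \<in> consistent i (snd m)"
proof -
  let ?s = "insert_strategy i si s"
  have upmost: "snd m \<in> upmost"
    using assms(3) by (rule node_in_upmost)
  have "fst ?s \<in> nature_strategies G"
    using assms(2) by (simp add: insert_strategy_def opponent_profiles_def mem_Times_iff)
  moreover have "snd ?s k \<in> strategies G k" if "k \<in> players G" for k
  proof (cases "k = i")
    case False
    have "snd s \<in> Pi\<^sub>E (players G - {i}) (strategies G)"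
      using assms(2) by (simp add: opponent_profiles_def mem_Times_iff)
    then have "snd s k \<in> strategies G k"
      by (rule PiE_mem) (simp add: False that)
    then show ?thesis
      using False by (simp add: insert_strategy_def)
  qed (simp add: insert_strategy_def assms(1))
  ultimately have "\<And>l j. l \<in> dec_nodes G \<Longrightarrow> j \<in> active G l \<Longrightarrow>
      prescribed G ?s (upmost, l) j \<in> base_acts G l j"
    by (rule prescribed_feasible)
  \<comment> \<open>With a feasible profile, occurrence amounts to agreement at all predecessors;
    these conditions then split into those of the others and those of \<open>i\<close>.\<close>
  then have occ: "occurs G ?s m \<longleftrightarrow> (\<forall>n\<in>preds G (snd m). \<forall>j\<in>active G n.
      prescribed G ?s (upmost, n) j = action_towards G n (snd m) j)"
    unfolding occurs_def using prescribed_if_play play_if_prescribed upmost by blast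
  have "prescribed G ?s l j = prescribed G s l j" if "j \<noteq> Some i" for l j
    using that by (auto simp: prescribed_def insert_strategy_def split: option.splits)
  then have others: "(\<forall>n\<in>preds G (snd m). \<forall>j\<in>active G n - {Some i}.
       prescribed G s (upmost, n) j = action_towards G n (snd m) j) \<longleftrightarrow>
     (\<forall>n\<in>preds G (snd m). \<forall>j\<in>active G n - {Some i}.
       prescribed G ?s (upmost, n) j = action_towards G n (snd m) j)"
    by simp
  \<comment> \<open>Every predecessor is a decision node, so activity of \<open>i\<close> alone
    decides which of them are own nodes.\<close>
  have "n \<in> own_preds i (snd m) \<longleftrightarrow> n \<in> preds G (snd m) \<and> Some i \<in> active G n" for n
    using dec_if_prec upmost top_in_trees by (auto simp: own_preds_def active_nodes_def preds_def)
  then have "si \<in> consistent i (snd m) \<longleftrightarrow> (\<forall>n\<in>preds G (snd m). Some i \<in> active G n \<longrightarrow>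
      prescribed G ?s (upmost, n) (Some i) = action_towards G n (snd m) (Some i))"
    by (auto simp: consistent_def prescribed_def insert_strategy_def)
  then show ?thesis
    unfolding occ others by blast
qed

lemma conditional_strategy_equivalent:
  assumes "perfect_recall G i" "\<sigma> \<in> mixed_strategies G i"
  shows "realization_equivalent G i \<sigma> (conditional_strategy i \<sigma>)"
  unfolding realization_equivalent_def
proof (intro ballI)
  fix m s assume m: "m \<in> nodes G" and s: "s \<in> opponent_profiles G i"
  define ok where "ok \<longleftrightarrow> (\<forall>n\<in>preds G (snd m). \<forall>j\<in>active G n - {Some i}.
    prescribed G s (upmost, n) j = action_towards G n (snd m) j)"
  have supp: "set_pmf \<sigma> \<subseteq> strategies G i"
    using assms(2) by (simp add: mixed_strategies_def)
  \<comment> \<open>The restriction to \<open>strategies G i\<close> holds almost surely, since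
    \<sigma> is supported there.\<close>
  have "occ_mixed G i m \<sigma> s = measure_pmf.prob \<sigma> {si. ok \<and> si \<in> consistent i (snd m)}"
    unfolding occ_mixed_def using occurs_iff[OF _ s m] supp
    by (intro measure_pmf.finite_measure_eq_AE) (auto simp: AE_measure_pmf_iff ok_def)
  \<comment> \<open>\<open>ok\<close> concerns only the others, so the event is either
    \<open>consistent i (snd m)\<close> or empty.\<close>
  also have "\<dots> = (if ok then measure_pmf.prob \<sigma> (consistent i (snd m)) else 0)"
    by simp
  also have "\<dots> = occ_behavior G i m (conditional_strategy i \<sigma>) s"
    using prod_conditional_strategy[OF assms(1) node_in_upmost[OF m], of \<sigma>]
    by (auto simp: occ_behavior_def ok_def own_preds_def)
  finally show "occ_mixed G i m \<sigma> s = occ_behavior G i m (conditional_strategy i \<sigma>) s" .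
qed

end

theorem corollary2:
  fixes G :: "('i, 'n, 'a) game" and i :: 'i
  assumes "unawareness_game G"
    and "i \<in> players G"
    and "perfect_recall G i"
  shows "\<forall>\<sigma> \<in> mixed_strategies G i. \<exists>\<beta> \<in> behavior_strategies G i. realization_equivalent G i \<sigma> \<beta>"
proof -
  interpret unawareness_game G by (fact assms(1))
  show ?thesis
    using conditional_strategy_behavior conditional_strategy_equivalent[OF assms(3)] by blast
qed

end
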